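(* Let $I\subseteq\mathbb{R}$ be any interval and let $f:I\times I\to\mathbb{R}$ be a factorable real-valued function of two variables. Then $f$ is uniformly continuous on $I\times I$ if and only if $f$ preserves factorable double quasi-Cauchy sequences from $I\times I$.
   Context: A function $f:I\times I\to\mathbb{R}$ is called factorable if there are functions $g,h:I\to\mathbb{R}$ with $f(x,y)=g(x)h(y)$ for all $x,y\in I$. A double sequence is a family indexed by $(k,l)\in\mathbb{N}\times\mathbb{N}$, where $\mathbb{N}=\{1,2,3,\dots\}$. A double sequence $\{z_{k,l}\}$ in $\mathbb{R}$ or in $\mathbb{R}^2$ is quasi-Cauchy if for every $\epsilon>0$ there is $N\in\mathbb{N}$ such that $\max_{r,s\in\{0,1\}}|z_{k,l}-z_{k+r,l+s}|<\epsilon$ whenever $k,l>N$; here $|\cdot|$ is the absolute value on $\mathbb{R}$ or the Euclidean norm on $\mathbb{R}^2$. A double sequence $\{z_{k,l}\}$ of points of $I\times I$ is factorable if there are single sequences $\{x_k\}$ and $\{y_l\}$ in $I$ with $z_{k,l}=(x_k,y_l)$ for all $k,l$. The function $f$ preserves factorable double quasi-Cauchy sequences from $I\times I$ if, for every factorable quasi-Cauchy double sequence $\{z_{k,l}\}$ of points of $I\times I$, the real double sequence $\{f(z_{k,l})\}$ is quasi-Cauchy. Uniform continuity is with respect to the Euclidean metric on $I\times I\subseteq\mathbb{R}^2$. *)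

theory Defs
  imports "HOL-Analysis.Analysis"
begin

definition factorable_on :: "real set \<Rightarrow> (real \<times> real \<Rightarrow> real) \<Rightarrow> bool" where
  "factorable_on I f \<longleftrightarrow> (\<exists>g h. \<forall>x\<in>I. \<forall>y\<in>I. f (x, y) = g x * h y)"

text \<open>
  Double sequences are functions of two natural numbers of which only the values at
  indices \<open>\<ge> 1\<close> are relevant; the entries with an index \<open>0\<close> are never inspected.
  The library norm on \<^typ>\<open>real \<times> real\<close> is the Euclidean one.
\<close>

definition double_quasi_Cauchy :: "(nat \<Rightarrow> nat \<Rightarrow> 'a::real_normed_vector) \<Rightarrow> bool" where
  "double_quasi_Cauchy z \<longleftrightarrow>
     (\<forall>\<epsilon>>0. \<exists>N\<ge>1. \<forall>k l. k > N \<and> l > N \<longrightarrow>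
        (MAX (r, s)\<in>{0, 1} \<times> {0, 1}. norm (z k l - z (k + r) (l + s))) < \<epsilon>)"

definition factorable_double_seq :: "real set \<Rightarrow> (nat \<Rightarrow> nat \<Rightarrow> real \<times> real) \<Rightarrow> bool" where
  "factorable_double_seq I z \<longleftrightarrow>
     (\<exists>x y. (\<forall>k\<ge>1. x k \<in> I) \<and> (\<forall>l\<ge>1. y l \<in> I) \<and>
            (\<forall>k\<ge>1. \<forall>l\<ge>1. z k l = (x k, y l)))"

definition preserves_factorable_double_quasi_Cauchy ::
    "real set \<Rightarrow> (real \<times> real \<Rightarrow> real) \<Rightarrow> bool" where
  "preserves_factorable_double_quasi_Cauchy I f \<longleftrightarrow>
     (\<forall>z. factorable_double_seq I z \<and> double_quasi_Cauchy z \<longrightarrow>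
          double_quasi_Cauchy (\<lambda>k l. f (z k l)))"

end

theory Submission
  imports Defs
begin

text \<open>
  Uniform continuity transports quasi-Cauchy double sequences for the same reason that it
  transports Cauchy sequences: close arguments have close values.

  Conversely, \<open>f\<close> is uniformly continuous as soon as it is uniformly continuous in each
  variable separately, with a modulus that does not depend on the other variable
  (\<open>uniformly_continuous_on_Times\<close>).  Suppose that this fails in the first variable.  Then
  there are \<open>\<epsilon> > 0\<close> and points \<open>a\<^sub>n\<close>, \<open>a'\<^sub>n\<close>, \<open>b\<^sub>n\<close> of \<open>I\<close> such that
  \<open>\<bar>a\<^sub>n - a'\<^sub>n\<bar>\<close> tends to \<open>0\<close> while \<open>\<bar>f (a\<^sub>n, b\<^sub>n) - f (a'\<^sub>n, b\<^sub>n)\<bar> \<ge> \<epsilon>\<close>.  Since \<open>I\<close> is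
  an interval, one can walk through all the points \<open>a\<^sub>0, a'\<^sub>0, a\<^sub>1, a'\<^sub>1, \<dots>\<close> with steps that
  shrink to \<open>0\<close>, and in such a way that each \<open>a'\<^sub>n\<close> comes directly after \<open>a\<^sub>n\<close>
  (\<open>slow_walk_through_sequence\<close>); another such walk visits all the \<open>b\<^sub>n\<close>.  The two walks form
  a factorable quasi-Cauchy double sequence.  It meets \<open>(a\<^sub>n, b\<^sub>n)\<close> and \<open>(a'\<^sub>n, b\<^sub>n)\<close> at
  neighbouring positions with arbitrarily large indices, so its image under \<open>f\<close> is not
  quasi-Cauchy (\<open>preserves_imp_equicontinuous_fst\<close>).  The second variable is treated by
  transposing.
\<close>

section \<open>Quasi-Cauchy double sequences\<close>

lemma double_quasi_Cauchy_iff: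
  "double_quasi_Cauchy z \<longleftrightarrow>
     (\<forall>\<epsilon>>0. \<exists>N. \<forall>k>N. \<forall>l>N. \<forall>r\<in>{0,1}. \<forall>s\<in>{0,1}. norm (z k l - z (k + r) (l + s)) < \<epsilon>)"
proof -
  have Max: "(MAX (r, s)\<in>{0, 1} \<times> {0, 1}. norm (z k l - z (k + r) (l + s))) < \<epsilon> \<longleftrightarrow>
      (\<forall>r\<in>{0,1}. \<forall>s\<in>{0,1}. norm (z k l - z (k + r) (l + s)) < \<epsilon>)" for k l \<epsilon>
    by (subst Max_less_iff) auto
  \<comment> \<open>The bound \<open>N \<ge> 1\<close> is harmless, since \<open>N\<close> may always be enlarged.\<close>
  have shift: "(\<exists>N\<ge>1. \<forall>k l. k > N \<and> l > N \<longrightarrow> P k l) \<longleftrightarrow> (\<exists>N. \<forall>k>N. \<forall>l>N. P k l)"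
    for P :: "nat \<Rightarrow> nat \<Rightarrow> bool"
  proof
    assume "\<exists>N. \<forall>k>N. \<forall>l>N. P k l"
    then obtain N where "\<And>k l. k > N \<Longrightarrow> l > N \<Longrightarrow> P k l" by blast
    then have "Suc N \<ge> 1 \<and> (\<forall>k l. k > Suc N \<and> l > Suc N \<longrightarrow> P k l)" by simp
    then show "\<exists>N\<ge>1. \<forall>k l. k > N \<and> l > N \<longrightarrow> P k l" by (rule exI)
  qed blast
  show ?thesis
    unfolding double_quasi_Cauchy_def Max shift ..
qed

lemma double_quasi_Cauchy_transpose:
  assumes "double_quasi_Cauchy z"
  shows "double_quasi_Cauchy (\<lambda>k l. z l k)"
  unfolding double_quasi_Cauchy_iff
proof (intro allI impI)
  fix \<epsilon> :: real assume "\<epsilon> > 0"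
  then obtain N where N: "\<And>k l r s. k > N \<Longrightarrow> l > N \<Longrightarrow> r \<in> {0,1} \<Longrightarrow> s \<in> {0,1} \<Longrightarrow>
      norm (z k l - z (k + r) (l + s)) < \<epsilon>"
    using assms unfolding double_quasi_Cauchy_iff by metis
  show "\<exists>N. \<forall>k>N. \<forall>l>N. \<forall>r\<in>{0,1}. \<forall>s\<in>{0,1}. norm (z l k - z (l + s) (k + r)) < \<epsilon>"
    by (intro exI[of _ N] allI impI ballI N)
qed

lemma double_quasi_Cauchy_swap:
  fixes z :: "nat \<Rightarrow> nat \<Rightarrow> 'a::real_normed_vector \<times> 'b::real_normed_vector"
  assumes "double_quasi_Cauchy z"
  shows "double_quasi_Cauchy (\<lambda>k l. prod.swap (z k l))"
proof -
  have "norm (prod.swap p - prod.swap q) = norm (p - q)" for p q :: "'a \<times> 'b"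
    by (cases p; cases q) (simp add: norm_Pair add.commute)
  then show ?thesis
    using assms unfolding double_quasi_Cauchy_iff by simp
qed

lemma double_quasi_Cauchy_Pair:
  fixes x :: "nat \<Rightarrow> 'a::real_normed_vector" and y :: "nat \<Rightarrow> 'b::real_normed_vector"
  assumes x: "(\<lambda>k. x (Suc k) - x k) \<longlonglongrightarrow> 0" and y: "(\<lambda>l. y (Suc l) - y l) \<longlonglongrightarrow> 0"
  shows "double_quasi_Cauchy (\<lambda>k l. (x k, y l))"
  unfolding double_quasi_Cauchy_iff
proof (intro allI impI)
  fix \<epsilon> :: real assume "\<epsilon> > 0"
  then have "\<epsilon> / 2 > 0" by simp
  obtain M where M: "\<forall>k\<ge>M. norm (x (Suc k) - x k) < \<epsilon> / 2"
    using LIMSEQ_D[OF x \<open>\<epsilon> / 2 > 0\<close>] by auto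
  obtain N where N: "\<forall>l\<ge>N. norm (y (Suc l) - y l) < \<epsilon> / 2"
    using LIMSEQ_D[OF y \<open>\<epsilon> / 2 > 0\<close>] by auto
  have "norm ((x k, y l) - (x (k + r), y (l + s))) < \<epsilon>"
    if "k > max M N" "l > max M N" "r \<in> {0,1}" "s \<in> {0,1}" for k l r s
  proof -
    have "norm (x k - x (k + r)) < \<epsilon> / 2" "norm (y l - y (l + s)) < \<epsilon> / 2"
      using that M N \<open>\<epsilon> > 0\<close> by (auto simp: norm_minus_commute)
    then show ?thesis
      using norm_Pair_le[of "x k - x (k + r)" "y l - y (l + s)"] by simp
  qed
  then show "\<exists>N. \<forall>k>N. \<forall>l>N. \<forall>r\<in>{0,1}. \<forall>s\<in>{0,1}.
      norm ((x k, y l) - (x (k + r), y (l + s))) < \<epsilon>"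
    by blast
qed

lemma uniformly_continuous_on_double_quasi_Cauchy:
  assumes f: "uniformly_continuous_on S f" and z: "double_quasi_Cauchy z"
    and S: "\<And>k l. k \<ge> 1 \<Longrightarrow> l \<ge> 1 \<Longrightarrow> z k l \<in> S"
  shows "double_quasi_Cauchy (\<lambda>k l. f (z k l))"
  unfolding double_quasi_Cauchy_iff
proof (intro allI impI)
  fix \<epsilon> :: real assume "\<epsilon> > 0"
  then obtain \<delta> where \<delta>: "\<delta> > 0"
    "\<And>u v. u \<in> S \<Longrightarrow> v \<in> S \<Longrightarrow> dist v u < \<delta> \<Longrightarrow> dist (f v) (f u) < \<epsilon>"
    using f unfolding uniformly_continuous_on_def by metis
  obtain N where N: "\<forall>k>N. \<forall>l>N. \<forall>r\<in>{0,1}. \<forall>s\<in>{0,1}. norm (z k l - z (k + r) (l + s)) < \<delta>"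
    using z \<open>\<delta> > 0\<close> unfolding double_quasi_Cauchy_iff by blast
  have "norm (f (z k l) - f (z (k + r) (l + s))) < \<epsilon>"
    if "k > N" "l > N" "r \<in> {0,1}" "s \<in> {0,1}" for k l r s
  proof -
    have "norm (z k l - z (k + r) (l + s)) < \<delta>"
      using N that by blast
    moreover have "z k l \<in> S" "z (k + r) (l + s) \<in> S"
      using that by (auto intro!: S)
    ultimately show ?thesis
      using \<delta>(2)[of "z (k + r) (l + s)" "z k l"] by (simp add: dist_norm)
  qed
  then show "\<exists>N. \<forall>k>N. \<forall>l>N. \<forall>r\<in>{0,1}. \<forall>s\<in>{0,1}.
      norm (f (z k l) - f (z (k + r) (l + s))) < \<epsilon>"
    by blast
qed

section \<open>Slow walks in convex sets\<close>

text \<open>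
  The walk goes from \<open>c n\<close> to \<open>c (Suc n)\<close> along the segment between them, in \<open>m n\<close> equal steps,
  where \<open>m n\<close> is just large enough to make these steps at most \<open>1 / Suc n\<close> long.  Hence a
  single step is used whenever the two points are already that close.
\<close>

lemma slow_walk_through_sequence:
  fixes c :: "nat \<Rightarrow> 'a::real_normed_vector"
  assumes "convex S" and c: "\<And>n. c n \<in> S"
  obtains x :: "nat \<Rightarrow> 'a" and \<phi> :: "nat \<Rightarrow> nat"
  where "\<And>j. x j \<in> S" and "(\<lambda>j. x (Suc j) - x j) \<longlonglongrightarrow> 0"
    and "strict_mono \<phi>" and "\<And>n. x (\<phi> n) = c n"
    and "\<And>n. norm (c (Suc n) - c n) \<le> 1 / Suc n \<Longrightarrow> \<phi> (Suc n) = Suc (\<phi> n)"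
proof -
  define m where "m n = max 1 (nat \<lceil>Suc n * norm (c (Suc n) - c n)\<rceil>)" for n
  define \<phi> where "\<phi> n = (\<Sum>i<n. m i)" for n
  have m_pos: "m n \<ge> 1" for n
    by (simp add: m_def)
  have \<phi>_Suc: "\<phi> (Suc n) = \<phi> n + m n" for n
    by (simp add: \<phi>_def)
  have mono: "strict_mono \<phi>"
    unfolding strict_mono_Suc_iff \<phi>_Suc using m_pos by (simp add: Suc_le_lessD)
  have step_le: "norm (c (Suc n) - c n) / m n \<le> 1 / Suc n" for n
  proof -
    have "Suc n * norm (c (Suc n) - c n) \<le> m n"
      unfolding m_def by linarith
    then show ?thesis
      using m_pos[of n] by (simp add: field_simps)
  qed
  have "\<exists>n. \<phi> n \<le> j \<and> j < \<phi> (Suc n)" for j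
  proof (induction j)
    case 0
    show ?case
      using m_pos[of 0] by (intro exI[of _ 0]) (simp add: \<phi>_def)
  next
    case (Suc j)
    then obtain n where n: "\<phi> n \<le> j" "j < \<phi> (Suc n)" by blast
    show ?case
    proof (cases "Suc j < \<phi> (Suc n)")
      case True
      with n show ?thesis by (intro exI[of _ n]) simp
    next
      case False
      with n have "Suc j = \<phi> (Suc n)" by simp
      then show ?thesis
        using strict_monoD[OF mono, of "Suc n" "Suc (Suc n)"] by (intro exI[of _ "Suc n"]) simp
    qed
  qed
  then obtain seg where seg: "\<And>j. \<phi> (seg j) \<le> j" "\<And>j. j < \<phi> (Suc (seg j))"
    by metis
  have seg_unique: "seg j = n" if "\<phi> n \<le> j" "j < \<phi> (Suc n)" for j n
  proof -
    have "\<phi> n < \<phi> (Suc (seg j))" "\<phi> (seg j) < \<phi> (Suc n)"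
      using seg[of j] that by linarith+
    then show ?thesis
      using strict_mono_less[OF mono] by (metis less_Suc_eq_le le_antisym)
  qed
  define p where
    "p n j = c n + ((real j - real (\<phi> n)) / m n) *\<^sub>R (c (Suc n) - c n)" for n j
  define x where "x j = p (seg j) j" for j
  have x_\<phi>: "x (\<phi> n) = c n" for n
  proof -
    have "seg (\<phi> n) = n"
      using strict_monoD[OF mono, of n "Suc n"] by (intro seg_unique) auto
    then show ?thesis
      by (simp add: x_def p_def)
  qed
  have p_end: "p n (\<phi> (Suc n)) = c (Suc n)" for n
    using m_pos[of n] by (simp add: p_def \<phi>_Suc)
  \<comment> \<open>At a turning point the formulas of both adjacent segments agree, so each step lies
    within a single segment.\<close>
  have x_Suc: "x (Suc j) = p (seg j) (Suc j)" for j
  proof (cases "Suc j < \<phi> (Suc (seg j))")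
    case True
    then have "seg (Suc j) = seg j"
      using seg[of j] by (intro seg_unique) auto
    then show ?thesis by (simp add: x_def)
  next
    case False
    then have "Suc j = \<phi> (Suc (seg j))"
      using seg[of j] by simp
    then show ?thesis
      using x_\<phi>[of "Suc (seg j)"] p_end[of "seg j"] by simp
  qed
  have step: "norm (x (Suc j) - x j) \<le> 1 / Suc (seg j)" for j
  proof -
    have "x (Suc j) - x j = (1 / m (seg j)) *\<^sub>R (c (Suc (seg j)) - c (seg j))"
      by (simp add: x_Suc) (simp add: x_def p_def flip: scaleR_diff_left diff_divide_distrib)
    then show ?thesis
      using step_le[of "seg j"] by simp
  qed
  show ?thesis
  proof
    show "x j \<in> S" for j
    proof -
      let ?n = "seg j"
      let ?t = "(real j - real (\<phi> ?n)) / m ?n"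
      have "0 \<le> ?t" "?t \<le> 1"
        using seg[of j] m_pos[of ?n] by (auto simp: \<phi>_Suc field_simps)
      moreover have "x j = (1 - ?t) *\<^sub>R c ?n + ?t *\<^sub>R c (Suc ?n)"
        by (simp add: x_def p_def algebra_simps)
      ultimately show ?thesis
        using convexD_alt[OF \<open>convex S\<close> c c] by metis
    qed
    show "(\<lambda>j. x (Suc j) - x j) \<longlonglongrightarrow> 0"
    proof (rule LIMSEQ_I)
      fix \<epsilon> :: real assume "\<epsilon> > 0"
      then obtain N where N: "inverse (real (Suc N)) < \<epsilon>"
        using reals_Archimedean by blast
      have "norm (x (Suc j) - x j - 0) < \<epsilon>" if "j \<ge> \<phi> N" for j
      proof -
        have "\<phi> N < \<phi> (Suc (seg j))"
          using that seg(2)[of j] by linarith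
        then have "N \<le> seg j"
          using strict_mono_less[OF mono] by (simp add: less_Suc_eq_le)
        then have "1 / Suc (seg j) \<le> 1 / Suc N"
          by (simp add: field_simps)
        then show ?thesis
          using step[of j] N by (simp add: inverse_eq_divide)
      qed
      then show "\<exists>M. \<forall>j\<ge>M. norm (x (Suc j) - x j - 0) < \<epsilon>"
        by blast
    qed
    show "strict_mono \<phi>" "\<And>n. x (\<phi> n) = c n"
      by (fact mono x_\<phi>)+
    show "\<phi> (Suc n) = Suc (\<phi> n)" if "norm (c (Suc n) - c n) \<le> 1 / Suc n" for n
    proof -
      have "Suc n * norm (c (Suc n) - c n) \<le> 1"
        using that by (simp add: field_simps)
      then have "m n = 1"
        unfolding m_def by (simp add: max_def) linarith
      then show ?thesis by (simp add: \<phi>_Suc)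
    qed
  qed
qed

section \<open>From preservation to uniform continuity\<close>

text \<open>
  A violation supplies points \<open>a\<^sub>n\<close>, \<open>a'\<^sub>n\<close>, \<open>b\<^sub>n\<close> with \<open>a'\<^sub>n\<close> close to \<open>a\<^sub>n\<close> but the values
  of \<open>f\<close> at \<open>(a\<^sub>n, b\<^sub>n)\<close> and \<open>(a'\<^sub>n, b\<^sub>n)\<close> far apart.  Interleaving the \<open>a\<^sub>n\<close> and \<open>a'\<^sub>n\<close> puts
  them at the positions \<open>2 * n\<close> and \<open>Suc (2 * n)\<close>; they are chosen at distance below
  \<open>1 / Suc (2 * n)\<close>, so that the slow walk goes from \<open>a\<^sub>n\<close> to \<open>a'\<^sub>n\<close> in one step.
\<close>

lemma preserves_imp_equicontinuous_fst:
  assumes I: "is_interval I" and f: "preserves_factorable_double_quasi_Cauchy I f" and "\<epsilon> > 0"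
  shows "\<exists>\<delta>>0. \<forall>a\<in>I. \<forall>a'\<in>I. \<forall>b\<in>I. \<bar>a' - a\<bar> < \<delta> \<longrightarrow> \<bar>f (a, b) - f (a', b)\<bar> < \<epsilon>"
proof (rule ccontr)
  assume contra: "\<not> ?thesis"
  have "\<exists>a\<in>I. \<exists>a'\<in>I. \<exists>b\<in>I. \<bar>a' - a\<bar> < 1 / Suc (2 * n) \<and> \<not> \<bar>f (a, b) - f (a', b)\<bar> < \<epsilon>" for n
  proof -
    have "(1::real) / Suc (2 * n) > 0" by simp
    then have "\<not> (\<forall>a\<in>I. \<forall>a'\<in>I. \<forall>b\<in>I.
        \<bar>a' - a\<bar> < 1 / Suc (2 * n) \<longrightarrow> \<bar>f (a, b) - f (a', b)\<bar> < \<epsilon>)"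
      using contra by (intro notI) (erule notE, intro exI conjI)
    then show ?thesis by blast
  qed
  then obtain a a' b where I_mem: "\<And>n. a n \<in> I" "\<And>n. a' n \<in> I" "\<And>n. b n \<in> I"
    and close: "\<And>n. \<bar>a' n - a n\<bar> < 1 / Suc (2 * n)"
    and far: "\<And>n. \<not> \<bar>f (a n, b n) - f (a' n, b n)\<bar> < \<epsilon>"
    by metis
  have "convex I"
    using I by (rule is_interval_convex)
  define c where "c n = (if even n then a (n div 2) else a' (n div 2))" for n
  have c_mem: "c n \<in> I" for n
    using I_mem by (simp add: c_def)
  obtain x \<phi> where x: "\<And>j. x j \<in> I" "(\<lambda>j. x (Suc j) - x j) \<longlonglongrightarrow> 0"
    and \<phi>: "strict_mono \<phi>" "\<And>n. x (\<phi> n) = c n"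
      "\<And>n. norm (c (Suc n) - c n) \<le> 1 / Suc n \<Longrightarrow> \<phi> (Suc n) = Suc (\<phi> n)"
    by (rule slow_walk_through_sequence[OF \<open>convex I\<close> c_mem]) (rule that)
  obtain y \<psi> where y: "\<And>j. y j \<in> I" "(\<lambda>j. y (Suc j) - y j) \<longlonglongrightarrow> 0"
    and \<psi>: "strict_mono \<psi>" "\<And>n. y (\<psi> n) = b n"
    by (rule slow_walk_through_sequence[OF \<open>convex I\<close> I_mem(3)]) (rule that)
  have "factorable_double_seq I (\<lambda>k l. (x k, y l))"
    unfolding factorable_double_seq_def
    by (intro exI[of _ x] exI[of _ y]) (simp add: x(1) y(1))
  then have "double_quasi_Cauchy (\<lambda>k l. f (x k, y l))"
    using f[unfolded preserves_factorable_double_quasi_Cauchy_def, THEN spec,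
        of "\<lambda>k l. (x k, y l)"] double_quasi_Cauchy_Pair[OF x(2) y(2)]
    by simp
  then obtain N where N: "\<forall>k>N. \<forall>l>N. \<forall>r\<in>{0,1}. \<forall>s\<in>{0,1}.
      norm (f (x k, y l) - f (x (k + r), y (l + s))) < \<epsilon>"
    using \<open>\<epsilon> > 0\<close> unfolding double_quasi_Cauchy_iff by blast
  let ?n = "Suc N"
  have "\<phi> (2 * ?n) > N" "\<psi> ?n > N"
    using strict_mono_imp_increasing[OF \<phi>(1), of "2 * ?n"]
      strict_mono_imp_increasing[OF \<psi>(1), of ?n] by simp_all
  then have "norm (f (x (\<phi> (2 * ?n)), y (\<psi> ?n)) - f (x (\<phi> (2 * ?n) + 1), y (\<psi> ?n + 0))) < \<epsilon>"
    using N by blast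
  moreover have "x (\<phi> (2 * ?n)) = a ?n"
    by (simp only: \<phi>(2)) (simp add: c_def)
  moreover have "x (\<phi> (2 * ?n) + 1) = a' ?n"
  proof -
    have "c (2 * ?n) = a ?n" "c (Suc (2 * ?n)) = a' ?n"
      by (simp_all add: c_def)
    then have "\<phi> (Suc (2 * ?n)) = Suc (\<phi> (2 * ?n))"
      using close[of ?n] by (intro \<phi>(3)) simp
    then show ?thesis
      using \<phi>(2)[of "Suc (2 * ?n)"] \<open>c (Suc (2 * ?n)) = a' ?n\<close> by simp
  qed
  ultimately show False
    using far[of ?n] by (simp add: \<psi>(2))
qed

lemma preserves_factorable_double_quasi_Cauchy_swap:
  assumes "preserves_factorable_double_quasi_Cauchy I f"
  shows "preserves_factorable_double_quasi_Cauchy I (\<lambda>p. f (prod.swap p))"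
  unfolding preserves_factorable_double_quasi_Cauchy_def
proof (intro allI impI, elim conjE)
  fix z :: "nat \<Rightarrow> nat \<Rightarrow> real \<times> real"
  assume fact: "factorable_double_seq I z" and z: "double_quasi_Cauchy z"
  obtain x y where "\<forall>k\<ge>1. x k \<in> I" "\<forall>l\<ge>1. y l \<in> I" "\<forall>k\<ge>1. \<forall>l\<ge>1. z k l = (x k, y l)"
    using fact unfolding factorable_double_seq_def by metis
  then have "factorable_double_seq I (\<lambda>k l. prod.swap (z l k))"
    unfolding factorable_double_seq_def by (intro exI[of _ y] exI[of _ x]) simp
  moreover have "double_quasi_Cauchy (\<lambda>k l. prod.swap (z l k))"
    by (rule double_quasi_Cauchy_swap[OF double_quasi_Cauchy_transpose[OF z]])
  ultimately have "double_quasi_Cauchy (\<lambda>k l. f (prod.swap (z l k)))"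
    using assms[unfolded preserves_factorable_double_quasi_Cauchy_def, THEN spec,
        of "\<lambda>k l. prod.swap (z l k)"]
    by simp
  then show "double_quasi_Cauchy (\<lambda>k l. f (prod.swap (z k l)))"
    by (rule double_quasi_Cauchy_transpose)
qed

lemma uniformly_continuous_on_Times:
  fixes f :: "'a::metric_space \<times> 'b::metric_space \<Rightarrow> 'c::metric_space"
  assumes fst: "\<And>\<epsilon>. \<epsilon> > 0 \<Longrightarrow>
      \<exists>\<delta>>0. \<forall>a\<in>A. \<forall>a'\<in>A. \<forall>b\<in>B. dist a' a < \<delta> \<longrightarrow> dist (f (a', b)) (f (a, b)) < \<epsilon>"
    and snd: "\<And>\<epsilon>. \<epsilon> > 0 \<Longrightarrow>
      \<exists>\<delta>>0. \<forall>b\<in>B. \<forall>b'\<in>B. \<forall>a\<in>A. dist b' b < \<delta> \<longrightarrow> dist (f (a, b')) (f (a, b)) < \<epsilon>"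
  shows "uniformly_continuous_on (A \<times> B) f"
  unfolding uniformly_continuous_on_def
proof (intro allI impI)
  fix \<epsilon> :: real assume "\<epsilon> > 0"
  then have "\<epsilon> / 2 > 0" by simp
  obtain \<delta> where "\<delta> > 0" and \<delta>:
    "\<forall>a\<in>A. \<forall>a'\<in>A. \<forall>b\<in>B. dist a' a < \<delta> \<longrightarrow> dist (f (a', b)) (f (a, b)) < \<epsilon> / 2"
    using fst[OF \<open>\<epsilon> / 2 > 0\<close>] by blast
  obtain \<eta> where "\<eta> > 0" and \<eta>:
    "\<forall>b\<in>B. \<forall>b'\<in>B. \<forall>a\<in>A. dist b' b < \<eta> \<longrightarrow> dist (f (a, b')) (f (a, b)) < \<epsilon> / 2"
    using snd[OF \<open>\<epsilon> / 2 > 0\<close>] by blast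
  have "dist (f q) (f p) < \<epsilon>"
    if pq: "p \<in> A \<times> B" "q \<in> A \<times> B" "dist q p < min \<delta> \<eta>" for p q
  proof -
    obtain a b where p: "p = (a, b)" by (cases p)
    obtain a' b' where q: "q = (a', b')" by (cases q)
    have "dist a' a < \<delta>" "dist b' b < \<eta>"
      using pq(3) dist_fst_le[of q p] dist_snd_le[of q p] by (auto simp: p q)
    then have "dist (f (a', b')) (f (a, b')) < \<epsilon> / 2" "dist (f (a, b')) (f (a, b)) < \<epsilon> / 2"
      using pq \<delta> \<eta> by (auto simp: p q)
    then show ?thesis
      unfolding p q using dist_triangle[of "f (a', b')" "f (a, b)" "f (a, b')"] by linarith
  qed
  then show "\<exists>d>0. \<forall>p\<in>A \<times> B. \<forall>q\<in>A \<times> B. dist q p < d \<longrightarrow> dist (f q) (f p) < \<epsilon>"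
    using \<open>\<delta> > 0\<close> \<open>\<eta> > 0\<close> by (intro exI[of _ "min \<delta> \<eta>"]) auto
qed

theorem theorem3p4:
  fixes I :: "real set" and f :: "real \<times> real \<Rightarrow> real"
  assumes "is_interval I" and "factorable_on I f"
  shows "uniformly_continuous_on (I \<times> I) f \<longleftrightarrow> preserves_factorable_double_quasi_Cauchy I f"
proof
  assume f: "uniformly_continuous_on (I \<times> I) f"
  show "preserves_factorable_double_quasi_Cauchy I f"
    unfolding preserves_factorable_double_quasi_Cauchy_def
  proof (intro allI impI, elim conjE)
    fix z assume fact: "factorable_double_seq I z" and z: "double_quasi_Cauchy z"
    have "z k l \<in> I \<times> I" if "k \<ge> 1" "l \<ge> 1" for k l
      using fact that by (auto simp: factorable_double_seq_def)
    then show "double_quasi_Cauchy (\<lambda>k l. f (z k l))"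
      by (rule uniformly_continuous_on_double_quasi_Cauchy[OF f z])
  qed
next
  assume f: "preserves_factorable_double_quasi_Cauchy I f"
  show "uniformly_continuous_on (I \<times> I) f"
  proof (rule uniformly_continuous_on_Times)
    fix \<epsilon> :: real assume "\<epsilon> > 0"
    show "\<exists>\<delta>>0. \<forall>a\<in>I. \<forall>a'\<in>I. \<forall>b\<in>I. dist a' a < \<delta> \<longrightarrow> dist (f (a', b)) (f (a, b)) < \<epsilon>"
      using preserves_imp_equicontinuous_fst[OF assms(1) f \<open>\<epsilon> > 0\<close>]
      by (simp add: dist_real_def abs_minus_commute)
    show "\<exists>\<delta>>0. \<forall>b\<in>I. \<forall>b'\<in>I. \<forall>a\<in>I. dist b' b < \<delta> \<longrightarrow> dist (f (a, b')) (f (a, b)) < \<epsilon>"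
      using preserves_imp_equicontinuous_fst[OF assms(1)
          preserves_factorable_double_quasi_Cauchy_swap[OF f] \<open>\<epsilon> > 0\<close>]
      by (simp add: dist_real_def abs_minus_commute)
  qed
qed

end
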